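(* Let $G$ be a finite simple graph and, for a positive integer $p$, let $Z_p(G)=\sum_{v\in V(G)}\deg(v)^p$ be its general first Zagreb index. For $k\ge 1$ let $S_k(G)$ denote the number of subgraphs of $G$ isomorphic to the star $K_{1,k}$. Then for every positive integer $p$, \[ Z_p(G)=2S_1(G)+\sum_{i=2}^{p} i!\left\{ {p \atop i}\right\} S_i(G). \]
   Context: $K_{1,k}$ is the star graph with one center and $k$ leaves; $S_k(G)$ counts its (not necessarily induced) copies in $G$ (so $S_1(G)$ is the number of edges, and $S_k(G)=0$ when $k\ge |V(G)|$). $\left\{ {p \atop i}\right\}$ denotes the Stirling number of the second kind. *)

theory Defs
  imports "Graph_Theory.Graph_Theory" "HOL-Combinatorics.Stirling"
begin

text \<open>
  Finite simple graphs are those of the locale \<^locale>\<open>graph\<close>: an undirected edge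
  \<open>{u, v}\<close> is represented by the two arcs from \<open>u\<close> to \<open>v\<close> and from \<open>v\<close> to \<open>u\<close>, and there are
  no loops and no parallel arcs.
\<close>

definition star :: "nat \<Rightarrow> nat pair_pre_digraph" where
  "star k = \<lparr>pverts = {0..k}, parcs = {0} \<times> {1..k} \<union> {1..k} \<times> {0}\<rparr>"

lemma complete_bipartite_star: "K\<^bsub>1,k\<^esub> (with_proj (star k))"
proof -
  have "\<exists>U V. {0..k} = U \<union> V \<and> U \<inter> V = {} \<and> card U = 1 \<and> card V = k \<and>
      {0} \<times> {1..k} \<union> {1..k} \<times> {0} = U \<times> V \<union> V \<times> U"
    by (intro exI[of _ "{0}"] exI[of _ "{1..k}"]) auto
  then show ?thesis
    by (simp add: complete_bipartite_digraph_pair_def star_def)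
qed

text \<open>
  \<^const>\<open>subgraph\<close> alone only yields subdigraphs, so \<^term>\<open>graph H\<close> restricts to undirected
  ones. As \<^const>\<open>subgraph\<close> also makes \<open>H\<close> share the \<^const>\<open>tail\<close> and \<^const>\<open>head\<close> functions of
  \<open>G\<close>, distinct \<open>H\<close> differ in their vertices or edges.
\<close>

definition num_stars :: "nat \<Rightarrow> ('a, 'b) pre_digraph \<Rightarrow> nat" where
  "num_stars k G =
    card {H. subgraph H G \<and> graph H \<and> digraph_iso H (with_proj (star k))}"

text \<open>In the symmetric representation the degree of a vertex is its \<^const>\<open>out_degree\<close>.\<close>

definition zagreb :: "nat \<Rightarrow> ('a, 'b) pre_digraph \<Rightarrow> nat" where
  "zagreb p G = (\<Sum>v\<in>verts G. out_degree G v ^ p)"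

end

theory Submission
  imports Defs
begin

text \<open>
  The copies of \<open>K\<^bsub>1,k\<^esub>\<close> are parametrised by a centre \<open>c\<close> together with a \<open>k\<close>-subset of the
  neighbours of \<open>c\<close>. For \<open>k \<ge> 2\<close> the centre is determined by the copy, whereas a copy of \<open>K\<^bsub>1,1\<^esub>\<close>
  has two centres. So the sum of \<open>deg v choose k\<close> over all vertices \<open>v\<close> is the number of \<open>k\<close>-stars
  for \<open>k \<ge> 2\<close> and twice that number for \<open>k = 1\<close>. The theorem follows by expanding \<open>deg v ^ p\<close> in
  binomial coefficients, which introduces the Stirling numbers.
\<close>

section \<open>Powers expanded in binomial coefficients\<close>

lemma times_binomial: "n * (n choose i) = i * (n choose i) + Suc i * (n choose Suc i)"
proof (cases "i \<le> n")
  case True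
  have "Suc i * (n choose Suc i) = (n - i) * (n choose i)"
    by (metis binomial_absorb_comp binomial_absorption)
  with True show ?thesis
    by (simp add: add_mult_distrib[symmetric])
qed (simp add: binomial_eq_0)

text \<open>Classifying the maps from a \<open>p\<close>-set to an \<open>n\<close>-set by the size
  \<open>i\<close> of their image gives this formula. The formal proof is by induction on
  \<open>p\<close>: \<open>times_binomial\<close> splits each term in two, matching the two terms of
  the Stirling recurrence.\<close>

lemma power_eq_sum_Stirling:
  "n ^ p = (\<Sum>i\<le>p. fact i * Stirling p i * (n choose i))" for n p :: nat
proof (induction p)
  case (Suc p)
  let ?f = "\<lambda>i. fact i * Stirling p i * (i * (n choose i))"
  \<comment> \<open>The shift keeps the upper bound: \<open>?f 0\<close> has the factor 0, and
    \<open>?f (Suc p)\<close> vanishes because \<open>Stirling p (Suc p) = 0\<close>.\<close>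
  have shift: "(\<Sum>i\<le>p. ?f i) = (\<Sum>i\<le>p. ?f (Suc i))"
    using sum.atMost_Suc_shift[of ?f p] by simp
  have "n ^ Suc p = (\<Sum>i\<le>p. fact i * Stirling p i * (n * (n choose i)))"
    by (simp add: Suc sum_distrib_left algebra_simps)
  also have "\<dots> = (\<Sum>i\<le>p. ?f i) + (\<Sum>i\<le>p. fact i * Stirling p i * (Suc i * (n choose Suc i)))"
    by (subst times_binomial) (simp only: distrib_left sum.distrib)
  also have "\<dots> = (\<Sum>i\<le>p. fact (Suc i) * Stirling (Suc p) (Suc i) * (n choose Suc i))"
    by (simp only: shift flip: sum.distrib) (simp add: algebra_simps)
  also have "\<dots> = (\<Sum>i\<le>Suc p. fact i * Stirling (Suc p) i * (n choose i))"
    by (subst sum.atMost_Suc_shift) simp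
  finally show ?case .
qed simp

section \<open>Stars described by a centre and a set of leaves\<close>

definition star_shape :: "'a \<Rightarrow> 'a set \<Rightarrow> ('a, 'b) pre_digraph \<Rightarrow> bool" where
  "star_shape c L H \<longleftrightarrow> c \<notin> L \<and> verts H = insert c L \<and> arcs_ends H = {c} \<times> L \<union> L \<times> {c}"

lemma wf_digraph_star: "wf_digraph (with_proj (star k))"
  by unfold_locales (auto simp: star_def)

lemma star_shape_if_digraph_iso:
  assumes "wf_digraph H" "digraph_iso H (with_proj (star k))"
  obtains c L where "star_shape c L H" "finite L" "card L = k"
proof -
  \<comment> \<open>The isomorphism is reversed so that \<open>H\<close> is an image of the concrete
    star; its centre is then the image of 0 and its leaves are the images of
    \<open>{1..k}\<close>.\<close>
  obtain f where f: "pre_digraph.digraph_isomorphism (with_proj (star k)) f"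
    and H: "H = app_iso f (with_proj (star k))"
    using digraph_iso_swap[OF assms] by (auto simp: digraph_iso_def)
  let ?g = "iso_verts f"
  have "inj_on ?g {0..k}"
    using pre_digraph.digraph_isomorphism_inj_on_verts[OF f] by (simp add: star_def)
  then have "card (?g ` {1..k}) = k" and "?g 0 \<notin> ?g ` {1..k}"
    by (auto simp: card_image inj_on_subset dest: inj_onD)
  moreover have "{0..k} = insert 0 {1..k}"
    by auto
  then have "verts H = insert (?g 0) (?g ` {1..k})"
    by (simp add: H star_def)
  moreover have "arcs_ends H = {?g 0} \<times> ?g ` {1..k} \<union> ?g ` {1..k} \<times> {?g 0}"
    unfolding H wf_digraph.arcs_ends_app_iso_eq[OF wf_digraph_star f]
    by (force simp: star_def)
  ultimately show thesis
    by (intro that[of "?g 0" "?g ` {1..k}"]) (auto simp: star_shape_def)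
qed

lemma (in nomulti_digraph) digraph_iso_if_star_shape:
  assumes G: "star_shape c L G" and "finite L" "card L = k"
  shows "digraph_iso G (with_proj (star k))"
proof -
  obtain g where g: "bij_betw g L {1..k}"
    using assms finite_same_card_bij[of L "{1..k}"] by auto
  define f where "f = g(c := 0)"
  have c: "c \<notin> L"
    using G by (simp add: star_shape_def)
  have [simp]: "f c = 0" "f ` L = {1..k}"
    using g c by (auto simp: f_def bij_betw_def)
  have "inj_on f L"
    using g c by (auto simp: f_def bij_betw_def inj_on_def)
  then have inj: "inj_on f (verts G)"
    using G \<open>f ` L = {1..k}\<close> by (fastforce simp: star_shape_def)
  \<comment> \<open>Arcs of \<open>star k\<close> are pairs of vertices, so an arc must go to the
    pair of images of its ends. This is injective on arcs because there are no parallel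
    arcs.\<close>
  define hom where "hom = \<lparr>iso_verts = f, iso_arcs = \<lambda>e. (f (tail G e), f (head G e)),
    iso_head = snd, iso_tail = fst\<rparr>"
  have "inj_on (\<lambda>e. (f (tail G e), f (head G e))) (arcs G)"
    using inj by (intro inj_onI no_multi_arcs) (auto simp: arc_to_ends_def inj_on_def)
  then have "digraph_isomorphism hom"
    using inj wf_digraph by (auto simp: digraph_isomorphism_def hom_def)
  moreover have "with_proj (star k) = app_iso hom G"
  proof -
    have "(\<lambda>e. (f (tail G e), f (head G e))) ` arcs G = map_prod f f ` arcs_ends G"
      by (auto simp: arcs_ends_conv image_image)
    also have "\<dots> = {0} \<times> {1..k} \<union> {1..k} \<times> {0}"
      using G by (simp add: star_shape_def image_Un map_prod_surj_on)
    finally have "iso_arcs hom ` arcs G = {0} \<times> {1..k} \<union> {1..k} \<times> {0}"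
      by (simp add: hom_def)
    moreover have "f ` verts G = {0..k}"
      using G by (auto simp: star_shape_def)
    ultimately show ?thesis
      by (simp add: star_def app_iso_def with_proj_def hom_def)
  qed
  ultimately show ?thesis
    by (auto simp: digraph_iso_def)
qed

text \<open>Without parallel arcs, an arc is determined by its ends. So \<open>star_shape\<close>,
  which sees arcs only through their ends, pins down a subgraph of \<open>G\<close>.\<close>

lemma (in nomulti_digraph) subgraph_eqI:
  assumes "subgraph H G" "subgraph K G" "verts H = verts K" "arcs_ends H = arcs_ends K"
  shows "H = K"
proof -
  have t: "tail H = tail G" "head H = head G" "tail K = tail G" "head K = head G"
    using assms by (auto simp: subgraph_def compatible_def)
  then have "arc_to_ends G ` arcs H = arc_to_ends G ` arcs K"
    using assms by (simp add: arcs_ends_conv arc_to_ends_def)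
  then have "arcs H = arcs K"
    using inj_on_image_eq_iff[OF inj_on_arc_to_ends] assms by (auto simp: subgraph_def)
  with t assms show ?thesis
    by (intro pre_digraph.equality) auto
qed

text \<open>If the centres differed, every arc leaving \<open>c\<close> would have to end in
  \<open>c'\<close>, leaving room for one leaf only.\<close>

lemma star_shape_center_unique:
  assumes "star_shape c L H" "star_shape c' L' H" "2 \<le> card L"
  shows "c = c'"
proof (rule ccontr)
  assume "c \<noteq> c'"
  have "{c} \<times> L \<subseteq> {c'} \<times> L' \<union> L' \<times> {c'}"
    using assms(1,2) unfolding star_shape_def by blast
  with \<open>c \<noteq> c'\<close> have "L \<subseteq> {c'}"
    by blast
  then have "card L \<le> 1"
    using card_mono[of "{c'}" L] by simp
  with assms show False by simp
qed

lemma star_shape_leaves: "star_shape c L H \<Longrightarrow> L = verts H - {c}"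
  by (auto simp: star_shape_def)

section \<open>Stars inside a given graph\<close>

definition nbrs :: "('a, 'b) pre_digraph \<Rightarrow> 'a \<Rightarrow> 'a set" where
  "nbrs G v = {w. v \<rightarrow>\<^bsub>G\<^esub> w}"

text \<open>All arcs of \<open>G\<close> between \<open>c\<close> and \<open>L\<close> are kept, in
  both directions, so that the result is again an undirected graph.\<close>

definition star_at :: "('a, 'b) pre_digraph \<Rightarrow> 'a \<Rightarrow> 'a set \<Rightarrow> ('a, 'b) pre_digraph" where
  "star_at G c L = \<lparr>verts = insert c L,
    arcs = {e \<in> arcs G. arc_to_ends G e \<in> {c} \<times> L \<union> L \<times> {c}}, tail = tail G, head = head G\<rparr>"

context graph
begin

lemma nbrs_subset: "nbrs G v \<subseteq> verts G"
  by (auto simp: nbrs_def dest: adj_in_verts)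

lemma finite_nbrs [simp]: "finite (nbrs G v)"
  using nbrs_subset finite_verts by (rule finite_subset)

lemma card_nbrs: "card (nbrs G v) = out_degree G v"
proof -
  have "nbrs G v = head G ` out_arcs G v"
    by (auto simp: nbrs_def arcs_ends_conv)
  moreover have "inj_on (head G) (out_arcs G v)"
    by (intro inj_onI no_multi_arcs) (auto simp: arc_to_ends_def)
  ultimately show ?thesis
    by (simp add: out_degree_def card_image)
qed

lemma star_shape_star_at:
  assumes "L \<subseteq> nbrs G c"
  shows "star_shape c L (star_at G c L)"
proof -
  have "c \<notin> L"
    using assms adj_not_same by (auto simp: nbrs_def)
  \<comment> \<open>Adjacency only provides the arcs out of \<open>c\<close>; the returning ones
    come from the symmetry of \<open>G\<close>.\<close>
  moreover have "{c} \<times> L \<union> L \<times> {c} \<subseteq> arcs_ends G"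
    using assms graph_symmetric by (auto simp: nbrs_def)
  then have "arcs_ends (star_at G c L) = {c} \<times> L \<union> L \<times> {c}"
    unfolding arcs_ends_def arc_to_ends_def star_at_def by auto
  ultimately show ?thesis
    by (simp add: star_shape_def star_at_def)
qed

lemma subgraph_star_at:
  assumes "c \<in> verts G" "L \<subseteq> nbrs G c"
  shows "subgraph (star_at G c L) G"
proof -
  have "wf_digraph (star_at G c L)"
    by unfold_locales (auto simp: star_at_def arc_to_ends_def)
  then show ?thesis
    using assms nbrs_subset wf_digraph by (auto simp: subgraph_def compatible_def star_at_def)
qed

lemma graph_star_at:
  assumes "c \<in> verts G" "L \<subseteq> nbrs G c"
  shows "graph (star_at G c L)"
proof -
  interpret S: digraph "star_at G c L"
    using digraph_subgraph[OF subgraph_star_at[OF assms]] .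
  have "symmetric (star_at G c L)"
    using star_shape_star_at[OF assms(2)] by (auto simp: symmetric_def star_shape_def sym_def)
  then show ?thesis ..
qed

section \<open>Counting copies through centred stars\<close>

definition centered_stars :: "nat \<Rightarrow> ('a \<times> 'a set) set" where
  "centered_stars k = (SIGMA v:verts G. {L. L \<subseteq> nbrs G v \<and> card L = k})"

lemma finite_centered_stars: "finite (centered_stars k)"
  unfolding centered_stars_def by (auto intro!: finite_SigmaI)

lemma card_centered_stars: "card (centered_stars k) = (\<Sum>v\<in>verts G. out_degree G v choose k)"
  unfolding centered_stars_def by (subst card_SigmaI) (auto simp: n_subsets card_nbrs)

lemma stars_eq_image:
  "{H. subgraph H G \<and> graph H \<and> digraph_iso H (with_proj (star k))} =
    (\<lambda>(c, L). star_at G c L) ` centered_stars k" (is "?A = ?B")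
proof (intro equalityI subsetI)
  fix H assume "H \<in> ?A"
  then have H: "subgraph H G" "digraph_iso H (with_proj (star k))" and "wf_digraph H"
    by auto
  then obtain c L where cL: "star_shape c L H" "card L = k"
    using star_shape_if_digraph_iso by blast
  have "c \<in> verts G" "L \<subseteq> nbrs G c"
    using cL H adj_mono[OF _ H(1)] by (auto simp: star_shape_def subgraph_def nbrs_def)
  \<comment> \<open>Both sides are subgraphs of \<open>G\<close> with the same vertices and the same
    arc ends.\<close>
  moreover from this have "H = star_at G c L"
    using H cL star_shape_star_at[of L c]
    by (intro subgraph_eqI subgraph_star_at) (auto simp: star_shape_def)
  ultimately show "H \<in> ?B"
    using cL by (auto simp: centered_stars_def)
next
  fix H assume "H \<in> ?B"
  then obtain c L where cL: "c \<in> verts G" "L \<subseteq> nbrs G c" "card L = k" and H: "H = star_at G c L"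
    by (auto simp: centered_stars_def)
  interpret S: graph H
    unfolding H using cL graph_star_at by blast
  have "digraph_iso H (with_proj (star k))"
    using cL star_shape_star_at finite_subset[OF cL(2)]
    by (intro S.digraph_iso_if_star_shape) (auto simp: H)
  then show "H \<in> ?A"
    using subgraph_star_at[of c L] cL S.graph_axioms by (simp add: H)
qed

text \<open>With at least two leaves a copy determines its centre and hence its leaves, so
  \<open>star_at\<close> is injective on centred stars.\<close>

lemma num_stars_eq:
  assumes "2 \<le> k"
  shows "num_stars k G = (\<Sum>v\<in>verts G. out_degree G v choose k)"
proof -
  have "inj_on (\<lambda>(c, L). star_at G c L) (centered_stars k)"
  proof (rule inj_onI, clarify)
    fix c L c' L'
    assume cL: "(c, L) \<in> centered_stars k" "(c', L') \<in> centered_stars k"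
      and eq: "star_at G c L = star_at G c' L'"
    from cL have "star_shape c L (star_at G c L)" "star_shape c' L' (star_at G c' L')" "card L = k"
      by (auto simp: centered_stars_def star_shape_star_at)
    with eq have *: "star_shape c L (star_at G c L)" "star_shape c' L' (star_at G c L)" "card L = k"
      by simp_all
    then have "c = c'"
      using assms star_shape_center_unique by metis
    with * show "c = c' \<and> L = L'"
      by (metis star_shape_leaves)
  qed
  then show ?thesis
    unfolding num_stars_def stars_eq_image by (simp add: card_image card_centered_stars)
qed

text \<open>Each fibre of \<open>star_at\<close> over a single edge has exactly two elements, one
  for each choice of the end serving as centre.\<close>

lemma two_num_stars_1: "2 * num_stars 1 G = (\<Sum>v\<in>verts G. out_degree G v)"
proof -
  let ?f = "\<lambda>(c, L). star_at G c L" and ?C = "centered_stars 1"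
  have "card {x \<in> ?C. ?f x = H} = 2" if "H \<in> ?f ` ?C" for H
  proof -
    from that obtain c l where c: "c \<in> verts G" "c \<rightarrow> l" and H: "H = star_at G c {l}"
      by (auto simp: centered_stars_def nbrs_def card_1_singleton_iff)
    then have l: "l \<in> verts G" "l \<rightarrow> c" and "c \<noteq> l"
      using adj_in_verts graph_symmetric adj_not_same by auto
    have "star_at G l {c} = H"
      by (auto simp: H star_at_def)
    moreover have "(x, L) = (c, {l}) \<or> (x, L) = (l, {c})"
      if "(x, L) \<in> ?C" "star_at G x L = H" for x L
    proof -
      have L: "card L = 1" "L \<subseteq> nbrs G x"
        using that by (auto simp: centered_stars_def)
      then obtain y where y: "L = {y}"
        by (auto simp: card_1_singleton_iff)
      have "star_shape x L H"
        using star_shape_star_at[OF L(2)] that(2) by simp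
      moreover have "star_shape c {l} H"
        unfolding H using c by (intro star_shape_star_at) (simp add: nbrs_def)
      \<comment> \<open>The arc from \<open>x\<close> to its leaf must be one of the two arcs of
        \<open>H\<close>.\<close>
      ultimately have "{x} \<times> L \<subseteq> {c} \<times> {l} \<union> {l} \<times> {c}"
        unfolding star_shape_def by blast
      with y show ?thesis
        by auto
    qed
    ultimately have "{x \<in> ?C. ?f x = H} = {(c, {l}), (l, {c})}"
      using c l H by (auto simp: centered_stars_def nbrs_def)
    with \<open>c \<noteq> l\<close> show ?thesis by simp
  qed
  then have "card ?C = card (?f ` ?C) * 2"
    using sum.image_gen[OF finite_centered_stars, of "\<lambda>_. 1::nat" 1 ?f] by simp
  then show ?thesis
    unfolding num_stars_def stars_eq_image by (simp add: card_centered_stars)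
qed

end

theorem theorem4:
  fixes G :: "('a, 'b) pre_digraph" and p :: nat
  assumes "graph G" and "p > 0"
  shows "zagreb p G =
    2 * num_stars 1 G + (\<Sum>i = 2..p. fact i * Stirling p i * num_stars i G)"
proof -
  interpret graph G by fact
  let ?s = "\<lambda>i. fact i * Stirling p i * (\<Sum>v\<in>verts G. out_degree G v choose i)"
  have "zagreb p G = (\<Sum>i\<le>p. ?s i)"
    unfolding zagreb_def power_eq_sum_Stirling
    by (subst sum.swap) (simp add: sum_distrib_left)
  \<comment> \<open>Indices 0 and 1 are split off, since binomial sums equal star counts only from 2
    on.\<close>
  also have "{..p} = insert 0 (insert 1 {2..p})"
    using \<open>p > 0\<close> by auto
  also have "(\<Sum>i\<in>\<dots>. ?s i) = ?s 0 + ?s 1 + (\<Sum>i = 2..p. ?s i)"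
    by simp
  \<comment> \<open>\<open>Stirling p 0 = 0\<close> for positive \<open>p\<close>.\<close>
  also have "?s 0 = 0"
    using \<open>p > 0\<close> by (cases p) auto
  \<comment> \<open>Here \<open>Stirling p 1 = 1\<close>, and the sum of the degrees is twice the
    number of edges.\<close>
  also have "?s 1 = 2 * num_stars 1 G"
    using \<open>p > 0\<close> unfolding two_num_stars_1
    by (cases p) (simp_all del: Stirling.simps)
  also have "(\<Sum>i = 2..p. ?s i) = (\<Sum>i = 2..p. fact i * Stirling p i * num_stars i G)"
    by (intro sum.cong) (auto simp: num_stars_eq)
  finally show ?thesis by simp
qed

end
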